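(* Let $\Gamma$ be a finite or countably infinite polymorphism homogeneous weakly connected oriented graph. Then $\Gamma$ is one of the following: (1) $I_1$; (2) $C_3$; (3) $(\mathbb{Q},<)$; (4) an extension of the countable universal homogeneous strict poset.
   Context: An oriented graph is a pair $\Gamma=(V,E)$ with $V$ a non-empty set and $E\subseteq V^2$ an asymmetric relation; write $x\to y$ for $(x,y)\in E$, $x\sim y$ if $x\to y$ or $y\to x$. $\Gamma$ is weakly connected if any two vertices are joined by a finite sequence $x=z_0\sim\dots\sim z_k=y$. A homomorphism is an arc-preserving map; $\Gamma$ is homomorphism homogeneous if every homomorphism between finite induced subgraphs extends to an endomorphism. The $n$-th direct power $\Gamma^n$ has vertex set $V^n$ and arcs $((v_i)_i,(w_i)_i)$ with $(v_i,w_i)\in E$ for all $i$. $\Gamma$ is polymorphism homogeneous if $\Gamma^n$ is homomorphism homogeneous for all $n\ge1$. $I_1$ is the one-vertex graph with no arcs; $C_3$ is the directed 3-cycle; a strict poset $(P,<)$ is regarded as the oriented graph with $x\to y$ iff $x<y$. The countable universal homogeneous strict poset is the Fraïssé limit of the class of all finite strict posets; an extension of a poset $(A,<_1)$ is a poset $(A,<_2)$ with $<_1\subseteq<_2$. *)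

theory Defs
  imports Complex_Main "HOL-Library.Countable_Set" "HOL-Library.FuncSet"
begin

text \<open>
  A directed graph is given by its vertex set \<open>V\<close> and its arc relation \<open>E\<close>; the subgraph of
  \<open>(V, E)\<close> induced on \<open>A \<subseteq> V\<close> is \<open>(A, Restr E A)\<close>.
\<close>

definition oriented_graph :: "'a set \<Rightarrow> 'a rel \<Rightarrow> bool" where
  "oriented_graph V E \<longleftrightarrow> V \<noteq> {} \<and> E \<subseteq> V \<times> V \<and> asym E"

definition weakly_connected :: "'a set \<Rightarrow> 'a rel \<Rightarrow> bool" where
  "weakly_connected V E \<longleftrightarrow> (\<forall>x\<in>V. \<forall>y\<in>V. (x, y) \<in> (E \<union> E\<inverse>)\<^sup>*)"

definition graph_hom :: "'a set \<Rightarrow> 'a rel \<Rightarrow> 'b set \<Rightarrow> 'b rel \<Rightarrow> ('a \<Rightarrow> 'b) \<Rightarrow> bool" where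
  "graph_hom V E W F f \<longleftrightarrow> f \<in> V \<rightarrow> W \<and> (\<forall>(x, y)\<in>E. (f x, f y) \<in> F)"

definition graph_embedding :: "'a set \<Rightarrow> 'a rel \<Rightarrow> 'b set \<Rightarrow> 'b rel \<Rightarrow> ('a \<Rightarrow> 'b) \<Rightarrow> bool" where
  "graph_embedding V E W F f \<longleftrightarrow>
     f \<in> V \<rightarrow> W \<and> inj_on f V \<and> (\<forall>x\<in>V. \<forall>y\<in>V. (x, y) \<in> E \<longleftrightarrow> (f x, f y) \<in> F)"

definition graph_iso :: "'a set \<Rightarrow> 'a rel \<Rightarrow> 'b set \<Rightarrow> 'b rel \<Rightarrow> ('a \<Rightarrow> 'b) \<Rightarrow> bool" where
  "graph_iso V E W F f \<longleftrightarrow>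
     bij_betw f V W \<and> (\<forall>x\<in>V. \<forall>y\<in>V. (x, y) \<in> E \<longleftrightarrow> (f x, f y) \<in> F)"

definition isomorphic :: "'a set \<Rightarrow> 'a rel \<Rightarrow> 'b set \<Rightarrow> 'b rel \<Rightarrow> bool" where
  "isomorphic V E W F \<longleftrightarrow> (\<exists>f. graph_iso V E W F f)"

definition hom_homogeneous :: "'a set \<Rightarrow> 'a rel \<Rightarrow> bool" where
  "hom_homogeneous V E \<longleftrightarrow>
     (\<forall>A B f. A \<subseteq> V \<longrightarrow> finite A \<longrightarrow> B \<subseteq> V \<longrightarrow> finite B \<longrightarrow>
        graph_hom A (Restr E A) B (Restr E B) f \<longrightarrow>
        (\<exists>g. graph_hom V E V E g \<and> (\<forall>x\<in>A. g x = f x)))"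

text \<open>The elements of \<open>V\<close> to the power \<open>n\<close> are the extensional functions from \<open>{..<n}\<close> to \<open>V\<close>.\<close>

definition power_verts :: "nat \<Rightarrow> 'a set \<Rightarrow> (nat \<Rightarrow> 'a) set" where
  "power_verts n V = {..<n} \<rightarrow>\<^sub>E V"

definition power_arcs :: "nat \<Rightarrow> 'a set \<Rightarrow> 'a rel \<Rightarrow> (nat \<Rightarrow> 'a) rel" where
  "power_arcs n V E =
     {(v, w). v \<in> power_verts n V \<and> w \<in> power_verts n V \<and> (\<forall>i<n. (v i, w i) \<in> E)}"

definition poly_homogeneous :: "'a set \<Rightarrow> 'a rel \<Rightarrow> bool" where
  "poly_homogeneous V E \<longleftrightarrow> (\<forall>n\<ge>1. hom_homogeneous (power_verts n V) (power_arcs n V E))"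

definition C3_verts :: "nat set" where
  "C3_verts = {0, 1, 2}"

definition C3_arcs :: "nat rel" where
  "C3_arcs = {(0, 1), (1, 2), (2, 0)}"

definition strict_poset :: "'a set \<Rightarrow> 'a rel \<Rightarrow> bool" where
  "strict_poset V E \<longleftrightarrow> E \<subseteq> V \<times> V \<and> irrefl E \<and> trans E"

text \<open>Homogeneity in the sense of Fraisse (ultrahomogeneity).\<close>

definition iso_homogeneous :: "'a set \<Rightarrow> 'a rel \<Rightarrow> bool" where
  "iso_homogeneous V E \<longleftrightarrow>
     (\<forall>A B f. A \<subseteq> V \<longrightarrow> finite A \<longrightarrow> B \<subseteq> V \<longrightarrow> finite B \<longrightarrow>
        graph_iso A (Restr E A) B (Restr E B) f \<longrightarrow>
        (\<exists>g. graph_iso V E V E g \<and> (\<forall>x\<in>A. g x = f x)))"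

text \<open>
  A class \<open>K\<close> of finite structures is given by its members with vertices in \<open>nat\<close>: every finite
  structure is isomorphic to one of these. A Fraisse limit of \<open>K\<close> is a countable homogeneous
  structure whose age, the class of finite structures embeddable in it, is \<open>K\<close>; it is unique up
  to isomorphism.
\<close>

definition fraisse_limit :: "(nat set \<Rightarrow> nat rel \<Rightarrow> bool) \<Rightarrow> 'a set \<Rightarrow> 'a rel \<Rightarrow> bool" where
  "fraisse_limit K V E \<longleftrightarrow>
     E \<subseteq> V \<times> V \<and> countable V \<and> iso_homogeneous V E \<and>
     (\<forall>B R. finite B \<and> R \<subseteq> B \<times> B \<longrightarrow> (K B R \<longleftrightarrow> (\<exists>f. graph_embedding B R V E f)))"

definition countable_universal_homogeneous_poset :: "'a set \<Rightarrow> 'a rel \<Rightarrow> bool" where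
  "countable_universal_homogeneous_poset V E \<longleftrightarrow>
     fraisse_limit (\<lambda>B R. finite B \<and> strict_poset B R) V E"

definition poset_extension :: "'a set \<Rightarrow> 'a rel \<Rightarrow> 'a rel \<Rightarrow> bool" where
  "poset_extension V R E \<longleftrightarrow> strict_poset V R \<and> strict_poset V E \<and> R \<subseteq> E"

end

theory Submission
  imports Defs
begin

text \<open>
  Suppose \<open>E\<close> is not empty. If \<open>p \<rightarrow> r \<rightarrow> q\<close> in a power of the graph, then \<open>p\<close> and \<open>q\<close> are
  adjacent: otherwise both could be sent to the same vertex \<open>u\<close>, and the image \<open>v\<close> of \<open>r\<close> would
  satisfy \<open>u \<rightarrow> v \<rightarrow> u\<close>. In the square this rules out that the graph contains both a transitive and
  a cyclic triangle. Without transitive triangles the graph is \<open>C\<^sub>3\<close>. Otherwise \<open>E\<close> is transitive,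
  and mapping antichains in powers shows that for finite \<open>A < B\<close> there is \<open>v\<close> with \<open>A < v < B\<close>.
  Approximating by finite suborders of \<open>E\<close> one then obtains an order \<open>R \<subseteq> E\<close> with the extension
  property of the generic poset: for a new vertex prescribed to lie above \<open>A\<close>, below \<open>B\<close>
  and incomparable to other vertices, only the positive relations have to hold in \<open>E\<close>. In particular
  \<open>(\<rat>, <)\<close> need not be treated separately, being itself an extension of the generic poset.
\<close>

section \<open>Generic chains\<close>

text \<open>The requirements are met one per step along an enumeration of \<open>I\<close>. This
  serves both the back-and-forth construction and the approximation of a generic suborder by finite
  ones.\<close>

lemma rasiowa_sikorski:
  assumes "countable I" and "P p" and "reflp le" and "transp le"
    and dense: "\<And>i p. i \<in> I \<Longrightarrow> P p \<Longrightarrow> \<exists>q. P q \<and> le p q \<and> Q i q"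
  obtains s :: "nat \<Rightarrow> 'p" where "s 0 = p" "\<And>n. P (s n)" "\<And>m n. m \<le> n \<Longrightarrow> le (s m) (s n)"
    "\<And>i. i \<in> I \<Longrightarrow> \<exists>n. Q i (s n)"
proof -
  \<comment> \<open>\<open>from_nat_into I\<close> enumerates \<open>I\<close> only if
    \<open>I\<close> is nonempty, hence the guard; for empty \<open>I\<close>, reflexivity allows a
    constant step.\<close>
  have "\<exists>s. \<forall>n. (P (s n) \<and> (n = 0 \<longrightarrow> s n = p)) \<and>
      (le (s n) (s (Suc n)) \<and> (I \<noteq> {} \<longrightarrow> Q (from_nat_into I n) (s (Suc n))))"
  proof (rule dependent_nat_choice)
    show "\<exists>x. P x \<and> (0 = (0::nat) \<longrightarrow> x = p)" using assms(2) by blast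
  next
    fix x and n :: nat assume "P x \<and> (n = 0 \<longrightarrow> x = p)"
    then show "\<exists>y. (P y \<and> (Suc n = 0 \<longrightarrow> y = p)) \<and>
        (le x y \<and> (I \<noteq> {} \<longrightarrow> Q (from_nat_into I n) y))"
      using dense[of "from_nat_into I n" x] from_nat_into[of I n] reflpD[OF assms(3), of x]
      by (cases "I = {}") auto
  qed
  then obtain s where s: "\<And>n. P (s n)" "s 0 = p" "\<And>n. le (s n) (s (Suc n))"
    "\<And>n. I \<noteq> {} \<Longrightarrow> Q (from_nat_into I n) (s (Suc n))" by blast
  have "le (s m) (s n)" if "m \<le> n" for m n
    using that
  proof (induction n rule: dec_induct)
    case base
    then show ?case using assms(3) by (rule reflpD)
  next
    case (step n)
    then show ?case using s(3) assms(4) by (blast dest: transpD)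
  qed
  moreover have "\<exists>n. Q i (s n)" if "i \<in> I" for i
    using s(4) from_nat_into_surj[OF assms(1) that] that by blast
  ultimately show thesis using that s(1,2) by blast
qed

section \<open>The extension property of the generic poset\<close>

text \<open>If \<open>R\<close> is a strict order, these are exactly the conditions under which
  adding a point above \<open>L\<close>, below \<open>U\<close> and incomparable to the rest of
  \<open>D\<close> gives a strict poset again. Disjointness of \<open>L\<close> and \<open>U\<close>
  follows from irreflexivity.\<close>

definition one_point_type :: "'a rel \<Rightarrow> 'a set \<Rightarrow> 'a set \<Rightarrow> 'a set \<Rightarrow> bool" where
  "one_point_type R D L U \<longleftrightarrow> L \<subseteq> D \<and> U \<subseteq> D \<and> L \<times> U \<subseteq> R \<and>
     (\<forall>x\<in>D. \<forall>y\<in>L. (x, y) \<in> R \<longrightarrow> x \<in> L) \<and> (\<forall>x\<in>U. \<forall>y\<in>D. (x, y) \<in> R \<longrightarrow> y \<in> U)"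

definition realizes :: "'a rel \<Rightarrow> 'a set \<Rightarrow> 'a set \<Rightarrow> 'a set \<Rightarrow> 'a \<Rightarrow> bool" where
  "realizes R D L U v \<longleftrightarrow> v \<notin> D \<and> (\<forall>d\<in>D. ((d, v) \<in> R \<longleftrightarrow> d \<in> L) \<and> ((v, d) \<in> R \<longleftrightarrow> d \<in> U))"

definition extension_property :: "'a set \<Rightarrow> 'a rel \<Rightarrow> bool" where
  "extension_property V R \<longleftrightarrow>
     (\<forall>D L U. finite D \<longrightarrow> D \<subseteq> V \<longrightarrow> one_point_type R D L U \<longrightarrow> (\<exists>v\<in>V. realizes R D L U v))"

text \<open>A relation instead of a function, so that the back step is the forth step for the
  converse. The clause on equality makes \<open>F\<close> single-valued and injective.\<close>

definition partial_iso :: "'a rel \<Rightarrow> 'b rel \<Rightarrow> ('a \<times> 'b) set \<Rightarrow> bool" where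
  "partial_iso R S F \<longleftrightarrow> (\<forall>x y x' y'. (x, y) \<in> F \<longrightarrow> (x', y') \<in> F \<longrightarrow>
     (x = x' \<longleftrightarrow> y = y') \<and> ((x, x') \<in> R \<longleftrightarrow> (y, y') \<in> S))"

lemma partial_isoD:
  assumes "partial_iso R S F" "(x, y) \<in> F" "(x', y') \<in> F"
  shows "x = x' \<longleftrightarrow> y = y'" "(x, x') \<in> R \<longleftrightarrow> (y, y') \<in> S"
  using assms unfolding partial_iso_def by blast+

lemma partial_iso_converse: "partial_iso R S F \<Longrightarrow> partial_iso S R (F\<inverse>)"
  unfolding partial_iso_def by blast

text \<open>The position of \<open>x\<close> relative to \<open>Domain F\<close>, transported along
  \<open>F\<close>, is a one-point type over \<open>Range F\<close> because \<open>S\<close> is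
  transitive. Any vertex realizing it can be the image of \<open>x\<close>.\<close>

lemma partial_iso_extend:
  assumes "irrefl S" "trans S" "irrefl R" "extension_property V R"
    and F: "finite F" "F \<subseteq> W \<times> V" "partial_iso S R F" and "x \<in> W"
  shows "\<exists>y\<in>V. partial_iso S R (insert (x, y) F)"
proof (cases "x \<in> Domain F")
  case True
  then obtain y where "(x, y) \<in> F" by blast
  then have "insert (x, y) F = F" "y \<in> V" using F(2) by blast+
  then show ?thesis using F(3) by metis
next
  case False
  let ?L = "{y. \<exists>x'. (x', y) \<in> F \<and> (x', x) \<in> S}" and ?U = "{y. \<exists>x'. (x', y) \<in> F \<and> (x, x') \<in> S}"
  have "one_point_type R (Range F) ?L ?U"
    unfolding one_point_type_def
  proof (intro conjI ballI impI subsetI)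
    fix p assume "p \<in> ?L \<times> ?U"
    then show "p \<in> R" using partial_isoD(2)[OF F(3)] transD[OF assms(2)] by fast
  next
    fix y' y assume "y' \<in> Range F" "y \<in> ?L" "(y', y) \<in> R"
    then show "y' \<in> ?L" using partial_isoD(2)[OF F(3)] transD[OF assms(2)] by fast
  next
    fix y y' assume "y \<in> ?U" "y' \<in> Range F" "(y, y') \<in> R"
    then show "y' \<in> ?U" using partial_isoD(2)[OF F(3)] transD[OF assms(2)] by fast
  qed auto
  moreover have "finite (Range F)" "Range F \<subseteq> V" using F by (auto intro: finite_Range)
  ultimately obtain v where v: "v \<in> V" "realizes R (Range F) ?L ?U v"
    using assms(4) unfolding extension_property_def by blast
  have "(x', x) \<in> S \<longleftrightarrow> (y', v) \<in> R" "(x, x') \<in> S \<longleftrightarrow> (v, y') \<in> R" "x \<noteq> x'" "v \<noteq> y'"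
    if "(x', y') \<in> F" for x' y'
    using v(2) that False partial_isoD(1)[OF F(3)] unfolding realizes_def by blast+
  moreover have "(x, x) \<notin> S" "(v, v) \<notin> R" using assms(1,3) by (auto simp: irrefl_def)
  ultimately have "partial_iso S R (insert (x, v) F)"
    using F(3) unfolding partial_iso_def by blast
  then show ?thesis using v(1) by blast
qed

text \<open>Back-and-forth: the union of a generic chain of finite partial isomorphisms, starting
  with the graph of \<open>f\<close>, is an automorphism.\<close>

lemma extension_property_iso_homogeneous:
  assumes "countable V" and R: "irrefl R" "trans R" "extension_property V R"
  shows "iso_homogeneous V R"
  unfolding iso_homogeneous_def
proof (intro allI impI)
  fix A B f
  assume A: "A \<subseteq> V" "finite A" and B: "B \<subseteq> V" "finite B"
    and f: "graph_iso A (Restr R A) B (Restr R B) f"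
  define P where "P F \<longleftrightarrow> finite F \<and> F \<subseteq> V \<times> V \<and> partial_iso R R F" for F
  have fB: "f x \<in> B" if "x \<in> A" for x
    using f that by (auto simp: graph_iso_def bij_betw_def)
  have "partial_iso R R ((\<lambda>x. (x, f x)) ` A)"
    using f fB unfolding partial_iso_def graph_iso_def bij_betw_def inj_on_def by blast
  then have P0: "P ((\<lambda>x. (x, f x)) ` A)" using A B fB unfolding P_def by auto
  have forth: "\<exists>y\<in>V. P (insert (x, y) F)" if "P F" "x \<in> V" for F x
    using partial_iso_extend[OF R(1,2,1,3), of F V x] that unfolding P_def by auto
  have conv: "P (F\<inverse>)" if "P F" for F
    using that partial_iso_converse unfolding P_def by auto
  \<comment> \<open>Extending \<open>F\<close> puts \<open>x\<close> into the domain; extending the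
    converse of the result puts \<open>x\<close> into the range.\<close>
  have dense: "\<exists>G. P G \<and> F \<subseteq> G \<and> x \<in> Domain G \<inter> Range G" if "x \<in> V" "P F" for x F
  proof -
    obtain y where "P (insert (x, y) F)" using forth \<open>P F\<close> \<open>x \<in> V\<close> by blast
    then obtain z where "P (insert (x, z) ((insert (x, y) F)\<inverse>))"
      using forth conv \<open>x \<in> V\<close> by blast
    then have "P ((insert (x, z) ((insert (x, y) F)\<inverse>))\<inverse>)" by (rule conv)
    then show ?thesis by - (intro exI conjI, assumption, auto)
  qed
  obtain s :: "nat \<Rightarrow> _" where s: "s 0 = (\<lambda>x. (x, f x)) ` A" "\<And>n. P (s n)" "\<And>m n. m \<le> n \<Longrightarrow> s m \<subseteq> s n"
    and tot: "\<And>x. x \<in> V \<Longrightarrow> \<exists>n. x \<in> Domain (s n) \<inter> Range (s n)"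
  proof (rule rasiowa_sikorski[where P = P and le = "(\<subseteq>)" and Q = "\<lambda>x G. x \<in> Domain G \<inter> Range G",
        OF assms(1) P0 _ _ dense])
    show "reflp ((\<subseteq>) :: ('a \<times> 'a) set \<Rightarrow> _)" by (rule reflpI) (rule order_refl)
    show "transp ((\<subseteq>) :: ('a \<times> 'a) set \<Rightarrow> _)" by (rule transpI) (rule order_trans)
    fix s :: "nat \<Rightarrow> ('a \<times> 'a) set"
    assume "s 0 = (\<lambda>x. (x, f x)) ` A" "\<And>n. P (s n)" "\<And>m n. m \<le> n \<Longrightarrow> s m \<subseteq> s n"
      "\<And>x. x \<in> V \<Longrightarrow> \<exists>n. x \<in> Domain (s n) \<inter> Range (s n)"
    then show thesis by (rule that)
  qed
  define G where "G = (\<Union>n. s n)"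
  have GV: "G \<subseteq> V \<times> V" using s(2) unfolding G_def P_def by blast
  have "partial_iso R R G"
    unfolding partial_iso_def
  proof (intro allI impI)
    fix x y x' y' assume "(x, y) \<in> G" "(x', y') \<in> G"
    then obtain m n where "(x, y) \<in> s m" "(x', y') \<in> s n" unfolding G_def by blast
    then have "(x, y) \<in> s (max m n)" "(x', y') \<in> s (max m n)"
      using s(3)[of m "max m n"] s(3)[of n "max m n"] by auto
    then show "(x = x' \<longleftrightarrow> y = y') \<and> ((x, x') \<in> R \<longleftrightarrow> (y, y') \<in> R)"
      using s(2)[of "max m n"] unfolding P_def partial_iso_def by blast
  qed
  note G = partial_isoD[OF this]
  have "\<forall>x\<in>V. \<exists>y. (x, y) \<in> G" using tot unfolding G_def by blast
  then obtain g where g: "\<And>x. x \<in> V \<Longrightarrow> (x, g x) \<in> G" by metis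
  have "bij_betw g V V"
    unfolding bij_betw_def
  proof
    show "inj_on g V" using g G(1) by (metis inj_onI)
    show "g ` V = V"
    proof
      show "g ` V \<subseteq> V" using g GV by blast
      show "V \<subseteq> g ` V"
      proof
        fix y assume "y \<in> V"
        then obtain x where "(x, y) \<in> G" using tot unfolding G_def by blast
        then show "y \<in> g ` V" using g G(1) GV by blast
      qed
    qed
  qed
  moreover have "\<forall>x\<in>V. \<forall>y\<in>V. (x, y) \<in> R \<longleftrightarrow> (g x, g y) \<in> R" using g G(2) by blast
  moreover have "g x = f x" if "x \<in> A" for x
  proof -
    have "(x, f x) \<in> G" using s(1) that unfolding G_def by blast
    then show ?thesis using g G(1) A(1) that by blast
  qed
  ultimately show "\<exists>g. graph_iso V R V R g \<and> (\<forall>x\<in>A. g x = f x)"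
    unfolding graph_iso_def by blast
qed

text \<open>The forth half of back-and-forth alone, started from the empty partial isomorphism and
  adding the elements of \<open>B\<close> one at a time.\<close>

lemma extension_property_embedding:
  assumes S: "irrefl S" "trans S" and R: "irrefl R" "extension_property V R" and "finite B"
  shows "\<exists>f. graph_embedding B S V R f"
proof -
  have "\<exists>F. finite F \<and> F \<subseteq> UNIV \<times> V \<and> partial_iso S R F \<and> B \<subseteq> Domain F"
    using \<open>finite B\<close>
  proof induction
    case empty
    show ?case by (rule exI[of _ "{}"]) (simp add: partial_iso_def)
  next
    case (insert b B)
    then obtain F where F: "finite F" "F \<subseteq> UNIV \<times> V" "partial_iso S R F" "B \<subseteq> Domain F" by blast
    obtain y where "y \<in> V" "partial_iso S R (Set.insert (b, y) F)"
      using partial_iso_extend[OF S R F(1-3)] by blast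
    then show ?case using F by (intro exI[of _ "Set.insert (b, y) F"]) auto
  qed
  then obtain F where F: "F \<subseteq> UNIV \<times> V" "partial_iso S R F" "B \<subseteq> Domain F" by blast
  then have "\<forall>x\<in>B. \<exists>y. (x, y) \<in> F" by blast
  then obtain f where f: "\<And>x. x \<in> B \<Longrightarrow> (x, f x) \<in> F" by metis
  have "f \<in> B \<rightarrow> V" using f F(1) by blast
  moreover have "inj_on f B" using f partial_isoD(1)[OF F(2)] by (metis inj_onI)
  moreover have "\<forall>x\<in>B. \<forall>y\<in>B. (x, y) \<in> S \<longleftrightarrow> (f x, f y) \<in> R"
    using f partial_isoD(2)[OF F(2)] by blast
  ultimately show ?thesis unfolding graph_embedding_def by blast
qed

lemma extension_property_imp_generic:
  assumes "countable V" "strict_poset V R" "extension_property V R"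
  shows "countable_universal_homogeneous_poset V R"
proof -
  have R: "R \<subseteq> V \<times> V" "irrefl R" "trans R" using assms(2) by (auto simp: strict_poset_def)
  have "strict_poset B S \<longleftrightarrow> (\<exists>f. graph_embedding B S V R f)"
    if B: "finite B" "S \<subseteq> B \<times> B" for B :: "nat set" and S
  proof
    assume "strict_poset B S"
    then show "\<exists>f. graph_embedding B S V R f"
      using extension_property_embedding R(2) assms(3) B(1) by (auto simp: strict_poset_def)
  next
    assume "\<exists>f. graph_embedding B S V R f"
    then obtain f where "\<And>x y. x \<in> B \<Longrightarrow> y \<in> B \<Longrightarrow> (x, y) \<in> S \<longleftrightarrow> (f x, f y) \<in> R"
      unfolding graph_embedding_def by blast
    then have iff: "(x, y) \<in> S \<longleftrightarrow> x \<in> B \<and> y \<in> B \<and> (f x, f y) \<in> R" for x y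
      using B(2) by blast
    have "irrefl S" using R(2) iff by (simp add: irrefl_def)
    moreover have "trans S" using transD[OF R(3)] iff by (blast intro: transI)
    ultimately show "strict_poset B S" using B(2) by (simp add: strict_poset_def)
  qed
  then show ?thesis
    using R(1) assms(1) extension_property_iso_homogeneous[OF assms(1) R(2,3) assms(3)]
    unfolding countable_universal_homogeneous_poset_def fraisse_limit_def by blast
qed

section \<open>A generic suborder\<close>

text \<open>The conditions are finite suborders of \<open>E\<close>, and each step realizes one
  prescribed type. The witness only needs its prescribed relations in \<open>E\<close>, which is
  what \<open>between\<close> provides; incomparability is obtained by leaving pairs out of the
  suborder.\<close>

lemma generic_suborder_exists:
  assumes "countable V" "strict_poset V E"
    and between: "\<And>A B C. finite A \<Longrightarrow> finite B \<Longrightarrow> finite C \<Longrightarrow> A \<subseteq> V \<Longrightarrow> B \<subseteq> V \<Longrightarrow> A \<times> B \<subseteq> E \<Longrightarrow>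
      \<exists>v\<in>V - C. A \<times> {v} \<subseteq> E \<and> {v} \<times> B \<subseteq> E"
  shows "\<exists>R \<subseteq> E. strict_poset V R \<and> extension_property V R"
proof -
  have E: "E \<subseteq> V \<times> V" "irrefl E" "trans E" using assms(2) by (auto simp: strict_poset_def)
  define P where "P = (\<lambda>(D, R). finite D \<and> D \<subseteq> V \<and> R \<subseteq> E \<and> R \<subseteq> D \<times> D \<and> trans R)"
  \<comment> \<open>The last clause freezes the order on \<open>D\<close>: pairs incomparable at one
    stage stay incomparable, so a realized type remains realized in the limit.\<close>
  define le where "le = (\<lambda>(D, R :: 'a rel) (D' :: 'a set, R').
    D \<subseteq> D' \<and> R \<subseteq> R' \<and> Restr R' D \<subseteq> R)"
  define Q where "Q = (\<lambda>(D, L, U) (D' :: 'a set, R). D \<subseteq> D' \<and>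
    (one_point_type R D L U \<longrightarrow> (\<exists>v\<in>D'. realizes R D L U v)))"
  let ?F = "{D. finite D \<and> D \<subseteq> V}"
  have count: "countable (?F \<times> ?F \<times> ?F)"
    using countable_Collect_finite_subset[OF assms(1)] by (simp add: countable_SIGMA)
  have P0: "P ({}, {})" by (simp add: P_def trans_def)
  have refl: "reflp le" by (auto simp: le_def reflp_def)
  have trans: "transp le"
    unfolding le_def transp_def by (clarsimp, intro conjI) blast+
  have dense: "\<exists>q. P q \<and> le p q \<and> Q i q" if "i \<in> ?F \<times> ?F \<times> ?F" "P p" for i p
  proof -
    obtain D L U where i: "i = (D, L, U)" by (cases i)
    obtain D0 R where p: "p = (D0, R)" by (cases p)
    have D: "finite D" "D \<subseteq> V" using that(1) i by auto
    have R: "finite D0" "D0 \<subseteq> V" "R \<subseteq> E" "R \<subseteq> D0 \<times> D0" "trans R"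
      using that(2) p by (auto simp: P_def)
    define D1 where "D1 = D0 \<union> D"
    have D1: "finite D1" "D1 \<subseteq> V" "D \<subseteq> D1" "D0 \<subseteq> D1" using D R by (auto simp: D1_def)
    show ?thesis
    proof (cases "one_point_type R D L U")
      case False
      then have "P (D1, R) \<and> le p (D1, R) \<and> Q i (D1, R)"
        unfolding P_def le_def Q_def p i using D1 R by auto
      then show ?thesis by blast
    next
      case True
      note t = True[unfolded one_point_type_def]
      \<comment> \<open>The type lives over \<open>D\<close>, but the new vertex also needs a
        consistent position relative to the rest of \<open>D1\<close>. The least choice is to close
        \<open>L\<close> downwards and \<open>U\<close> upwards.\<close>
      define L1 where "L1 = {x \<in> D1. \<exists>y\<in>L. x = y \<or> (x, y) \<in> R}"
      define U1 where "U1 = {x \<in> D1. \<exists>y\<in>U. x = y \<or> (y, x) \<in> R}"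
      have sub: "L1 \<subseteq> D1" "U1 \<subseteq> D1" by (auto simp: L1_def U1_def)
      have L1D: "x \<in> L1 \<longleftrightarrow> x \<in> L" "x \<in> U1 \<longleftrightarrow> x \<in> U" if "x \<in> D" for x
        using t that D1(3) unfolding L1_def U1_def by blast+
      have LU: "L1 \<times> U1 \<subseteq> R"
      proof clarify
        fix x y assume "x \<in> L1" "y \<in> U1"
        then obtain l u where "l \<in> L" "x = l \<or> (x, l) \<in> R" "u \<in> U" "y = u \<or> (u, y) \<in> R"
          unfolding L1_def U1_def by blast
        moreover from this have "(l, u) \<in> R" using t by blast
        ultimately show "(x, y) \<in> R" using transD[OF R(5)] by metis
      qed
      have down: "x \<in> L1" if "(x, y) \<in> R" "y \<in> L1" for x y
        using that transD[OF R(5)] R(4) D1(4) unfolding L1_def by blast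
      have up: "y \<in> U1" if "(x, y) \<in> R" "x \<in> U1" for x y
        using that transD[OF R(5)] R(4) D1(4) unfolding U1_def by blast
      obtain v where v: "v \<in> V" "v \<notin> D1" "L1 \<times> {v} \<subseteq> E" "{v} \<times> U1 \<subseteq> E"
        using between[of L1 U1 D1] sub D1(1,2) LU R(3) finite_subset[OF _ D1(1)] by blast
      \<comment> \<open>Further arcs of \<open>E\<close> between \<open>v\<close> and
        \<open>D1\<close> are deliberately omitted, which makes the other vertices of
        \<open>D1\<close> incomparable to \<open>v\<close>.\<close>
      define R' where "R' = R \<union> L1 \<times> {v} \<union> {v} \<times> U1"
      have iff: "(x, y) \<in> R' \<longleftrightarrow> (x, y) \<in> R \<or> x \<in> L1 \<and> y = v \<or> x = v \<and> y \<in> U1" for x y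
        by (auto simp: R'_def)
      have new: "(x, v) \<notin> R" "(v, x) \<notin> R" "v \<notin> L1" "v \<notin> U1" for x
        using v(2) sub R(4) D1(4) by auto
      have disj: "x \<notin> U1" if "x \<in> L1" for x
        using LU that R(3) E(2) unfolding irrefl_def by blast
      have "trans R'"
      proof (rule transI)
        fix x y z assume "(x, y) \<in> R'" "(y, z) \<in> R'"
        then show "(x, z) \<in> R'"
          unfolding iff using new LU down up disj transD[OF R(5), of x y z] by blast
      qed
      then have "P (insert v D1, R')"
        using D1 v R sub unfolding P_def R'_def by auto
      moreover have "le p (insert v D1, R')"
        using D1 v(2) unfolding le_def p R'_def by auto
      moreover have "realizes R' D L U v"
        using v(2) D1(3) L1D new unfolding realizes_def iff by blast
      then have "Q i (insert v D1, R')"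
        using D1(3) unfolding Q_def i by auto
      ultimately show ?thesis by blast
    qed
  qed
  obtain s :: "nat \<Rightarrow> _" where s: "\<And>n. P (s n)" "\<And>m n. m \<le> n \<Longrightarrow> le (s m) (s n)"
    "\<And>i. i \<in> ?F \<times> ?F \<times> ?F \<Longrightarrow> \<exists>n. Q i (s n)"
  proof (rule rasiowa_sikorski[where le = le and P = P and Q = Q, OF count P0 refl trans dense])
    fix s :: "nat \<Rightarrow> _"
    assume "\<And>n. P (s n)" "\<And>m n. m \<le> n \<Longrightarrow> le (s m) (s n)"
      "\<And>i. i \<in> ?F \<times> ?F \<times> ?F \<Longrightarrow> \<exists>n. Q i (s n)"
    then show thesis by (rule that)
  qed
  define R where "R = (\<Union>n. snd (s n))"
  have sn: "fst (s n) \<subseteq> V" "snd (s n) \<subseteq> E" "snd (s n) \<subseteq> fst (s n) \<times> fst (s n)" "trans (snd (s n))" for n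
    using s(1)[of n] by (auto simp: P_def split: prod.splits)
  have mono: "snd (s m) \<subseteq> snd (s n)" "Restr (snd (s n)) (fst (s m)) \<subseteq> snd (s m)" if "m \<le> n" for m n
    using s(2)[OF that] by (auto simp: le_def split: prod.splits)
  \<comment> \<open>By the freezing clause of \<open>le\<close>, no later stage adds a pair inside
    the domain of stage \<open>n\<close>.\<close>
  have restr: "(x, y) \<in> R \<longleftrightarrow> (x, y) \<in> snd (s n)" if "x \<in> fst (s n)" "y \<in> fst (s n)" for x y n
  proof
    assume "(x, y) \<in> R"
    then obtain m where "(x, y) \<in> snd (s m)" by (auto simp: R_def)
    then have "(x, y) \<in> snd (s (max m n))" using mono(1)[of m "max m n"] by auto
    then show "(x, y) \<in> snd (s n)" using mono(2)[of n "max m n"] that by auto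
  qed (auto simp: R_def)
  have "R \<subseteq> E" using sn(2) by (auto simp: R_def)
  moreover have "trans R"
  proof (rule transI)
    fix x y z assume "(x, y) \<in> R" "(y, z) \<in> R"
    then obtain m n where "(x, y) \<in> snd (s m)" "(y, z) \<in> snd (s n)" by (auto simp: R_def)
    then have "(x, y) \<in> snd (s (max m n))" "(y, z) \<in> snd (s (max m n))"
      using mono(1)[of m "max m n"] mono(1)[of n "max m n"] by auto
    then have "(x, z) \<in> snd (s (max m n))" using sn(4) transD by metis
    then show "(x, z) \<in> R" by (auto simp: R_def)
  qed
  ultimately have "strict_poset V R" using E by (auto simp: strict_poset_def irrefl_def)
  moreover have "extension_property V R"
    unfolding extension_property_def
  proof (intro allI impI)
    fix D L U assume D: "finite D" "D \<subseteq> V" and t: "one_point_type R D L U"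
    then have "(D, L, U) \<in> ?F \<times> ?F \<times> ?F"
      unfolding one_point_type_def by (blast intro: finite_subset)
    from s(3)[OF this] obtain n where "Q (D, L, U) (s n)" ..
    then have n: "D \<subseteq> fst (s n)"
      "one_point_type (snd (s n)) D L U \<Longrightarrow> \<exists>v\<in>fst (s n). realizes (snd (s n)) D L U v"
      by (auto simp: Q_def split: prod.splits)
    \<comment> \<open>The limit and stage \<open>n\<close> agree on \<open>D\<close>, so the type
      given in the limit is already a type at stage \<open>n\<close>, where it was realized.\<close>
    have "(x, y) \<in> R \<longleftrightarrow> (x, y) \<in> snd (s n)" if "x \<in> D" "y \<in> D" for x y
      using restr n(1) that by blast
    then have "one_point_type (snd (s n)) D L U"
      using t unfolding one_point_type_def by blast
    then obtain v where "v \<in> fst (s n)" "realizes (snd (s n)) D L U v" using n(2) by blast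
    moreover from this have "(d, v) \<in> R \<longleftrightarrow> (d, v) \<in> snd (s n)" "(v, d) \<in> R \<longleftrightarrow> (v, d) \<in> snd (s n)"
      if "d \<in> D" for d
      using restr n(1) that by blast+
    ultimately have "realizes R D L U v" "v \<in> V"
      using sn(1) unfolding realizes_def by blast+
    then show "\<exists>v\<in>V. realizes R D L U v" by blast
  qed
  ultimately show ?thesis using \<open>R \<subseteq> E\<close> by blast
qed

section \<open>Polymorphism homogeneous graphs\<close>

text \<open>The tuples \<open>t i\<close> and \<open>u\<close> of length \<open>n\<close> may take arbitrary values at indices \<open>\<ge> n\<close>.\<close>

lemma poly_homogeneous_extend:
  assumes "poly_homogeneous V E" and "1 \<le> (n :: nat)" and "finite I"
    and t: "\<And>i j. i \<in> I \<Longrightarrow> j < n \<Longrightarrow> t i j \<in> V" and u: "\<And>j. j < n \<Longrightarrow> u j \<in> V"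
    and f: "\<And>i. i \<in> I \<Longrightarrow> f i \<in> V"
    and inj: "\<And>i k. i \<in> I \<Longrightarrow> k \<in> I \<Longrightarrow> \<forall>j<n. t i j = t k j \<Longrightarrow> f i = f k"
    and arcs: "\<And>i k. i \<in> I \<Longrightarrow> k \<in> I \<Longrightarrow> \<forall>j<n. (t i j, t k j) \<in> E \<Longrightarrow> (f i, f k) \<in> E"
  obtains v where "v \<in> V" "\<And>i. i \<in> I \<Longrightarrow> \<forall>j<n. (t i j, u j) \<in> E \<Longrightarrow> (f i, v) \<in> E"
    "\<And>i. i \<in> I \<Longrightarrow> \<forall>j<n. (u j, t i j) \<in> E \<Longrightarrow> (v, f i) \<in> E"
proof -
  \<comment> \<open>Homogeneity of the power is applied to the map taking the tuple of
    \<open>i\<close> to the constant tuple \<open>f i\<close>. Arcs between constant tuples are just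
    arcs of \<open>E\<close>, so the answer can be read off in the graph itself.\<close>
  define T where "T i = restrict (t i) {..<n}" for i
  define c where "c i = restrict (\<lambda>_. f i) {..<n}" for i
  \<comment> \<open>Several indices may give the same tuple; \<open>inj\<close> makes the choice
    among them irrelevant.\<close>
  define h where "h w = c (SOME i. i \<in> I \<and> w = T i)" for w
  have T: "T i \<in> power_verts n V" "c i \<in> power_verts n V" if "i \<in> I" for i
    using t f that by (auto simp: T_def c_def power_verts_def)
  have hT: "h (T i) = c i" if "i \<in> I" for i
  proof -
    define k where "k = (SOME k. k \<in> I \<and> T i = T k)"
    have k: "k \<in> I" "T i = T k"
      using someI[of "\<lambda>k. k \<in> I \<and> T i = T k" i] that unfolding k_def by auto
    have "\<forall>j<n. t i j = t k j"
    proof (intro allI impI)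
      fix j assume "j < n"
      then show "t i j = t k j" using fun_cong[OF k(2), of j] by (simp add: T_def)
    qed
    then have "f i = f k" using inj that k(1) by blast
    then show ?thesis unfolding h_def k_def[symmetric] by (simp add: c_def)
  qed
  have "graph_hom (T ` I) (Restr (power_arcs n V E) (T ` I))
      (c ` I) (Restr (power_arcs n V E) (c ` I)) h"
    unfolding graph_hom_def
  proof
    show "h \<in> T ` I \<rightarrow> c ` I" using hT by auto
    have "(c i, c k) \<in> power_arcs n V E" if "i \<in> I" "k \<in> I" "(T i, T k) \<in> power_arcs n V E" for i k
      using that arcs[of i k] T by (auto simp: power_arcs_def T_def c_def)
    then show "\<forall>(x, y)\<in>Restr (power_arcs n V E) (T ` I). (h x, h y) \<in> Restr (power_arcs n V E) (c ` I)"
      using hT by auto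
  qed
  moreover have "T ` I \<subseteq> power_verts n V" "c ` I \<subseteq> power_verts n V" using T by auto
  moreover have "hom_homogeneous (power_verts n V) (power_arcs n V E)"
    using assms(1,2) by (simp add: poly_homogeneous_def)
  ultimately obtain g where g: "graph_hom (power_verts n V) (power_arcs n V E)
      (power_verts n V) (power_arcs n V E) g" "\<forall>x\<in>T ` I. g x = h x"
    using \<open>finite I\<close> unfolding hom_homogeneous_def by (metis finite_imageI)
  define w where "w = restrict u {..<n}"
  have w: "w \<in> power_verts n V" using u by (auto simp: w_def power_verts_def)
  have gT: "g (T i) = c i" if "i \<in> I" for i using g(2) hT that by simp
  have hom: "(g x, g y) \<in> power_arcs n V E" if "(x, y) \<in> power_arcs n V E" for x y
    using g(1) that unfolding graph_hom_def by blast
  show thesis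
  \<comment> \<open>The image of \<open>w\<close> need not be constant, but an arc between it and a
    constant tuple holds in every coordinate. Coordinate 0 exists since \<open>n\<close> is at least
    1.\<close>
  proof (rule that[of "g w 0"])
    show "g w 0 \<in> V"
      using g(1) w \<open>1 \<le> n\<close> unfolding graph_hom_def power_verts_def by fastforce
    show "(f i, g w 0) \<in> E" if "i \<in> I" "\<forall>j<n. (t i j, u j) \<in> E" for i
    proof -
      have "(T i, w) \<in> power_arcs n V E" using that T w by (auto simp: power_arcs_def T_def w_def)
      from hom[OF this] show ?thesis using gT[OF that(1)] \<open>1 \<le> n\<close> by (auto simp: power_arcs_def c_def)
    qed
    show "(g w 0, f i) \<in> E" if "i \<in> I" "\<forall>j<n. (u j, t i j) \<in> E" for i
    proof -
      have "(w, T i) \<in> power_arcs n V E" using that T w by (auto simp: power_arcs_def T_def w_def)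
      from hom[OF this] show ?thesis using gT[OF that(1)] \<open>1 \<le> n\<close> by (auto simp: power_arcs_def c_def)
    qed
  qed
qed

lemma poly_homogeneous_extend_vertex:
  assumes "poly_homogeneous V E" and "finite A" "A \<subseteq> V" "u \<in> V" "f \<in> A \<rightarrow> V"
    and "\<And>x y. x \<in> A \<Longrightarrow> y \<in> A \<Longrightarrow> (x, y) \<in> E \<Longrightarrow> (f x, f y) \<in> E"
  obtains v where "v \<in> V" "\<And>x. x \<in> A \<Longrightarrow> (x, u) \<in> E \<Longrightarrow> (f x, v) \<in> E"
    "\<And>x. x \<in> A \<Longrightarrow> (u, x) \<in> E \<Longrightarrow> (v, f x) \<in> E"
proof -
  obtain v where "v \<in> V" "\<And>x. x \<in> A \<Longrightarrow> \<forall>j<1::nat. (x, u) \<in> E \<Longrightarrow> (f x, v) \<in> E"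
    "\<And>x. x \<in> A \<Longrightarrow> \<forall>j<1::nat. (u, x) \<in> E \<Longrightarrow> (v, f x) \<in> E"
    by (rule poly_homogeneous_extend[OF assms(1) order_refl assms(2), of "\<lambda>x _. x" "\<lambda>_. u" f])
      (use assms(3-) in auto)
  then show thesis using that by simp
qed

locale poly_homogeneous_oriented =
  fixes V :: "'a set" and E :: "'a rel"
  assumes arc_verts: "E \<subseteq> V \<times> V" and asym: "asym E" and poly: "poly_homogeneous V E"
begin

lemma verts: "(x, y) \<in> E \<Longrightarrow> x \<in> V" "(x, y) \<in> E \<Longrightarrow> y \<in> V"
  using arc_verts by auto

lemma no_loop: "(x, x) \<notin> E"
  using asym by (meson asymD)

lemma path_ends_adjacent:
  assumes "1 \<le> (n :: nat)" and path: "\<And>j. j < n \<Longrightarrow> (p j, r j) \<in> E" "\<And>j. j < n \<Longrightarrow> (r j, q j) \<in> E"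
  shows "(\<forall>j<n. (p j, q j) \<in> E) \<or> (\<forall>j<n. (q j, p j) \<in> E)"
proof (rule ccontr)
  assume *: "\<not> ?thesis"
  let ?t = "\<lambda>b. if b then p else q"
  have "p 0 \<in> V" using path(1) \<open>1 \<le> n\<close> verts(1) by auto
  have t: "?t b j \<in> V" if "j < n" for b j using verts(1)[OF path(1)] verts(2)[OF path(2)] that by simp
  have r: "r j \<in> V" if "j < n" for j using path that verts by auto
  have nonadj: "\<not> (\<forall>j<n. (?t b j, ?t b' j) \<in> E)" for b b'
    using * no_loop \<open>1 \<le> n\<close> by (cases b; cases b') auto
  \<comment> \<open>Both ends are collapsed to \<open>p 0\<close>, which is merely some vertex: with
    the ends non-adjacent, there is no arc to preserve.\<close>
  obtain v where v: "\<And>b. \<forall>j<n. (?t b j, r j) \<in> E \<Longrightarrow> (p 0, v) \<in> E"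
    "\<And>b. \<forall>j<n. (r j, ?t b j) \<in> E \<Longrightarrow> (v, p 0) \<in> E"
    by (rule poly_homogeneous_extend[OF poly \<open>1 \<le> n\<close>, of "UNIV :: bool set" ?t r "\<lambda>_. p 0"])
      (use t r nonadj \<open>p 0 \<in> V\<close> in auto)
  have "(p 0, v) \<in> E" "(v, p 0) \<in> E" using v(1)[of True] v(2)[of False] path by auto
  then show False using asym by (meson asymD)
qed

lemma arc_comp_cases: "(x, y) \<in> E \<Longrightarrow> (y, z) \<in> E \<Longrightarrow> (x, z) \<in> E \<or> (z, x) \<in> E"
  using path_ends_adjacent[of 1 "\<lambda>_. x" "\<lambda>_. y" "\<lambda>_. z"] by (auto simp del: One_nat_def)

text \<open>In the square, \<open>(a, x)\<close>, \<open>(b, y)\<close>, \<open>(c, z)\<close> is a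
  path, so its ends are adjacent, with the same direction in both coordinates. The arc from
  \<open>a\<close> to \<open>c\<close> fixes that direction.\<close>

lemma transitive_triangle_imp_trans:
  assumes "(a, b) \<in> E" "(b, c) \<in> E" "(a, c) \<in> E"
  shows "trans E"
proof (rule transI)
  fix x y z assume xyz: "(x, y) \<in> E" "(y, z) \<in> E"
  let ?w = "\<lambda>a x j :: nat. if j = 0 then a else x"
  have "(\<forall>j<2. (?w a x j, ?w c z j) \<in> E) \<or> (\<forall>j<2. (?w c z j, ?w a x j) \<in> E)"
    using assms xyz by (intro path_ends_adjacent[of 2 _ "?w b y"]) auto
  moreover have "(c, a) \<notin> E" using assms(3) asym by (meson asymD)
  ultimately show "(x, z) \<in> E" by (auto dest: spec[of _ 0] spec[of _ "1 :: nat"])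
qed

text \<open>Moving one end of a fixed arc to \<open>x\<close> and extending the map to the other end
  gives a neighbour of \<open>x\<close> on either side.\<close>

lemma exists_neighbours:
  assumes "E \<noteq> {}" "x \<in> V"
  obtains y z where "(y, x) \<in> E" "(x, z) \<in> E"
proof -
  obtain a b where ab: "(a, b) \<in> E" using assms(1) by auto
  obtain y where "(y, x) \<in> E"
    using poly_homogeneous_extend_vertex[OF poly, of "{b}" a "\<lambda>_. x"] ab no_loop verts[OF ab] assms(2)
    by auto
  moreover obtain z where "(x, z) \<in> E"
    using poly_homogeneous_extend_vertex[OF poly, of "{a}" b "\<lambda>_. x"] ab no_loop verts[OF ab] assms(2)
    by auto
  ultimately show thesis using that by blast
qed

text \<open>Distinct out-neighbours \<open>y\<close>, \<open>y'\<close> of \<open>x\<close> would be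
  non-adjacent, so \<open>y\<close> may be sent to \<open>x\<close> and \<open>y'\<close> to
  \<open>y\<close>. The image \<open>v\<close> of \<open>x\<close> then has arcs to both
  \<open>x\<close> and \<open>y\<close>, completing a transitive triangle.\<close>

lemma out_neighbour_unique:
  assumes no_triangle: "\<And>a b c. (a, b) \<in> E \<Longrightarrow> (b, c) \<in> E \<Longrightarrow> (a, c) \<notin> E"
    and "(x, y) \<in> E" "(x, y') \<in> E"
  shows "y = y'"
proof (rule ccontr)
  assume "y \<noteq> y'"
  have nonadj: "(y, y') \<notin> E" "(y', y) \<notin> E" using no_triangle assms(2,3) by blast+
  obtain v where "(v, x) \<in> E" "(v, y) \<in> E"
  proof (rule poly_homogeneous_extend_vertex[OF poly, of "{y, y'}" x "\<lambda>w. if w = y then x else y"])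
    fix v assume "\<And>w. w \<in> {y, y'} \<Longrightarrow> (x, w) \<in> E \<Longrightarrow> (v, if w = y then x else y) \<in> E"
    from this[of y] this[of y'] show thesis using that assms(2,3) \<open>y \<noteq> y'\<close> by auto
  qed (use assms(2,3) verts nonadj no_loop in auto)
  then show False using no_triangle assms(2) by blast
qed

text \<open>Every path of length two closes to a directed 3-cycle, and out-neighbours are unique.
  Hence a 3-cycle is closed under neighbours in both directions, and by connectivity it is the whole
  graph.\<close>

lemma no_triangle_imp_C3:
  assumes no_triangle: "\<And>a b c. (a, b) \<in> E \<Longrightarrow> (b, c) \<in> E \<Longrightarrow> (a, c) \<notin> E"
    and "E \<noteq> {}" "weakly_connected V E"
  shows "isomorphic V E C3_verts C3_arcs"
proof -
  have unique: "b = b'" if "(a, b) \<in> E" "(a, b') \<in> E" for a b b'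
    using out_neighbour_unique no_triangle that by blast
  have cyc: "(c, a) \<in> E" if "(a, b) \<in> E" "(b, c) \<in> E" for a b c
    using arc_comp_cases no_triangle that by blast
  obtain x y where xy: "(x, y) \<in> E" using assms(2) by auto
  then obtain z where yz: "(y, z) \<in> E" using exists_neighbours[OF assms(2)] verts by metis
  have zx: "(z, x) \<in> E" using cyc xy yz by blast
  have out: "w' \<in> {x, y, z}" if "(w, w') \<in> E" "w \<in> {x, y, z}" for w w'
    using that xy yz zx unique by blast
  have "w \<in> {x, y, z}" if "(x, w) \<in> (E \<union> E\<inverse>)\<^sup>*" for w
    using that
  proof induction
    case (step w w')
    show ?case
    proof (cases "(w, w') \<in> E")
      case False
      \<comment> \<open>For a backward arc, the successor \<open>w''\<close> of \<open>w\<close>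
        lies on the cycle, and \<open>cyc\<close> makes \<open>w'\<close> the successor of
        \<open>w''\<close>.\<close>
      then have w': "(w', w) \<in> E" using step.hyps by auto
      obtain w'' where "(w, w'') \<in> E" using step.IH xy yz zx by blast
      then show ?thesis using out step.IH cyc w' by blast
    qed (use out step.IH in blast)
  qed simp
  then have V: "V = {x, y, z}"
    using assms(3) verts xy yz unfolding weakly_connected_def by blast
  have ne: "x \<noteq> y" "y \<noteq> z" "x \<noteq> z" using xy yz zx no_loop by auto
  have nE: "(y, x) \<notin> E" "(z, y) \<notin> E" "(x, z) \<notin> E" using xy yz zx asym by (meson asymD)+
  let ?f = "\<lambda>v. if v = x then 0 else if v = y then 1 else 2 :: nat"
  have "graph_iso V E C3_verts C3_arcs ?f"
    unfolding graph_iso_def V C3_verts_def C3_arcs_def bij_betw_def inj_on_def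
    using ne xy yz zx nE no_loop by auto
  then show ?thesis unfolding isomorphic_def by blast
qed

text \<open>Take a chain \<open>a0\<close>, \<open>a1\<close>, \<open>b\<close>, \<open>c0\<close>,
  \<open>c1\<close>. The elements of \<open>A\<close> are coded by pairwise non-adjacent tuples
  below the constant tuple \<open>b\<close>, those of \<open>B\<close> by such tuples above it. Arcs
  between codes lead only from \<open>A\<close> to \<open>B\<close>, so decoding preserves arcs
  whatever \<open>E\<close> does inside \<open>A\<close> and inside \<open>B\<close>. The image of
  the constant tuple \<open>b\<close> is the required vertex.\<close>

lemma finite_between:
  assumes "trans E" "E \<noteq> {}" and fin: "finite A" "finite B" and sub: "A \<subseteq> V" "B \<subseteq> V"
    and AB: "A \<times> B \<subseteq> E"
  shows "\<exists>v\<in>V. A \<times> {v} \<subseteq> E \<and> {v} \<times> B \<subseteq> E"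
proof -
  obtain b a1 a0 c0 c1 where arcs: "(a0, a1) \<in> E" "(a1, b) \<in> E" "(b, c0) \<in> E" "(c0, c1) \<in> E"
    using exists_neighbours[OF assms(2)] assms(2) verts by (metis ex_in_conv surj_pair)
  note tr = transD[OF assms(1)]
  show ?thesis
  proof (cases "A \<union> B = {}")
    case True
    then show ?thesis using verts(1)[OF arcs(3)] by auto
  next
    case False
    have disj: "x \<notin> B" if "x \<in> A" for x using AB that no_loop by blast
    obtain h n where h: "A \<union> B = h ` {..<n :: nat}"
      using finite_imp_nat_seg_image_inj_on[of "A \<union> B"] fin by (auto simp: lessThan_def)
    with False have "1 \<le> n" by (cases n) auto
    \<comment> \<open>At its own coordinates the code of \<open>x\<close> takes the value nearer to
      \<open>b\<close>, elsewhere the outer one. An arc between two codes from \<open>A\<close>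
      fails at a coordinate of its source, one between two codes from \<open>B\<close> at a
      coordinate of its target.\<close>
    let ?t = "\<lambda>x j. if x \<in> A then if h j = x then a1 else a0 else if h j = x then c0 else c1"
    have low: "(x, x') \<in> E" if "x \<in> {a0, a1}" "x' \<in> {b, c0, c1}" for x x'
      using that arcs tr by blast
    have up: "(b, x') \<in> E" if "x' \<in> {c0, c1}" for x'
      using that arcs tr by blast
    have not: "(a1, a1) \<notin> E" "(a1, a0) \<notin> E" "(c0, c0) \<notin> E" "(c1, c0) \<notin> E"
        "a0 \<noteq> a1" "c0 \<noteq> c1"
      using arcs no_loop tr by blast+
    have index: "\<exists>j<n. h j = x" if "x \<in> A \<union> B" for x using h that by auto
    have inj: "x = y" if xy: "x \<in> A \<union> B" "y \<in> A \<union> B" "\<forall>j<n. ?t x j = ?t y j" for x y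
    proof -
      obtain j where "j < n" "h j = x" using index xy(1) by blast
      moreover have "{a0, a1} \<inter> {c0, c1} = {}" using low no_loop by blast
      ultimately show ?thesis using xy(3) not by (auto split: if_splits)
    qed
    have pres: "(x, y) \<in> E" if xy: "x \<in> A \<union> B" "y \<in> A \<union> B" "\<forall>j<n. (?t x j, ?t y j) \<in> E" for x y
    proof -
      obtain i where i: "i < n" "h i = x" "(?t x i, ?t y i) \<in> E" using index xy by blast
      obtain j where j: "j < n" "h j = y" "(?t x j, ?t y j) \<in> E" using index xy by blast
      have "(c, a) \<notin> E" if "a \<in> {a0, a1}" "c \<in> {c0, c1}" for a c
        using low that no_loop tr by blast
      then have "x \<in> A" "y \<notin> A" using i j not by (auto split: if_splits)
      then show ?thesis using AB xy by blast
    qed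
    obtain v where "v \<in> V" and v: "\<And>x. x \<in> A \<union> B \<Longrightarrow> \<forall>j<n. (?t x j, b) \<in> E \<Longrightarrow> (x, v) \<in> E"
      "\<And>x. x \<in> A \<union> B \<Longrightarrow> \<forall>j<n. (b, ?t x j) \<in> E \<Longrightarrow> (v, x) \<in> E"
    proof (rule poly_homogeneous_extend[OF poly \<open>1 \<le> n\<close>, of "A \<union> B" ?t "\<lambda>_. b" "\<lambda>x. x"])
      show "?t x j \<in> V" for x j using arcs verts by auto
      show "b \<in> V" using arcs verts by blast
    qed (use fin sub inj pres in \<open>blast+\<close>)
    have "(x, v) \<in> E" if "x \<in> A" for x using v(1)[of x] low that by auto
    moreover have "(v, x) \<in> E" if "x \<in> B" for x
    proof (rule v(2))
      have "x \<notin> A" using disj that by blast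
      then show "\<forall>j<n. (b, ?t x j) \<in> E" using up by simp
    qed (use that in simp)
    ultimately show ?thesis using \<open>v \<in> V\<close> by blast
  qed
qed

text \<open>If the vertex found for \<open>C\<close> is the new forbidden \<open>c\<close>, then
  \<open>c\<close> itself may be added to \<open>A\<close>: a vertex above \<open>c\<close> differs
  from \<open>c\<close> because there are no loops. Hence the induction keeps \<open>A\<close>
  arbitrary.\<close>

lemma finite_between_avoiding:
  assumes "trans E" "E \<noteq> {}" and "finite C" and "finite A" "finite B" "A \<subseteq> V" "B \<subseteq> V" "A \<times> B \<subseteq> E"
  shows "\<exists>v\<in>V - C. A \<times> {v} \<subseteq> E \<and> {v} \<times> B \<subseteq> E"
  using assms(3-)
proof (induction C arbitrary: A rule: finite_induct)
  case empty
  then show ?case using finite_between[OF assms(1,2)] by simp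
next
  case (insert c C)
  obtain v where v: "v \<in> V - C" "A \<times> {v} \<subseteq> E" "{v} \<times> B \<subseteq> E"
    using insert.IH[OF insert.prems] by blast
  show ?case
  proof (cases "v = c")
    case True
    have "\<exists>w\<in>V - C. Set.insert c A \<times> {w} \<subseteq> E \<and> {w} \<times> B \<subseteq> E"
      using insert.prems v True by (intro insert.IH) auto
    then show ?thesis using no_loop by blast
  qed (use v in blast)
qed

end

theorem theorem3p6:
  fixes V :: "'a set" and E :: "'a rel"
  assumes "oriented_graph V E"
    and "countable V"
    and "weakly_connected V E"
    and "poly_homogeneous V E"
  shows "isomorphic V E {0::nat} {}
    \<or> isomorphic V E C3_verts C3_arcs
    \<or> isomorphic V E (UNIV :: rat set) {(x, y). x < y}
    \<or> (\<exists>R. countable_universal_homogeneous_poset V R \<and> poset_extension V R E)"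
proof -
  interpret poly_homogeneous_oriented V E
    using assms(1,4) by unfold_locales (auto simp: oriented_graph_def)
  \<comment> \<open>If the second case fails for nonempty \<open>E\<close>, there is a transitive
    triangle, and this forces \<open>E\<close> to be transitive.\<close>
  consider "E = {}" | "E \<noteq> {}" "\<And>a b c. (a, b) \<in> E \<Longrightarrow> (b, c) \<in> E \<Longrightarrow> (a, c) \<notin> E"
    | "E \<noteq> {}" "trans E"
    using transitive_triangle_imp_trans by blast
  then show ?thesis
  proof cases
    case 1
    obtain x where "x \<in> V" using assms(1) by (auto simp: oriented_graph_def)
    then have "V = {x}" using assms(3) 1 by (auto simp: weakly_connected_def)
    then have "graph_iso V E {0 :: nat} {} (\<lambda>_. 0)"
      using 1 by (simp add: graph_iso_def bij_betw_def)
    then show ?thesis unfolding isomorphic_def by blast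
  next
    case 2
    then show ?thesis using no_triangle_imp_C3 assms(3) by blast
  next
    case 3
    have E: "strict_poset V E"
      using 3 arc_verts no_loop by (auto simp: strict_poset_def irrefl_def)
    obtain R where "R \<subseteq> E" "strict_poset V R" "extension_property V R"
      using generic_suborder_exists[OF assms(2) E] finite_between_avoiding[OF 3(2,1)] by metis
    then show ?thesis
      using extension_property_imp_generic[OF assms(2)] E unfolding poset_extension_def by blast
  qed
qed

end
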